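(* Let $\Omega$ be an open set in $\mathbb{R}^N$, $N\geq 1$, $p>1$, $A\in C^1(\Omega)$, $A\geq 0$, and $X\in C^1(\Omega,\mathbb{R}^N)$. For $u\in C_0^1(\Omega)$ write $$G=\int_{\Omega}A|\nabla u|^{p}\,dx,\qquad G_X=\int_{\Omega}A\left|\frac{X}{|X|}\cdot\nabla u\right|^{p}dx,\qquad H=\int_{\Omega}A|X|^{p}|u|^{p}\,dx.$$ Then for any $u\in C_0^1(\Omega)$ we have $$G^{\frac1p}H^{\frac{p-1}{p}}+\frac1p\int_{\Omega}\operatorname{div}\left(A|X|^{p-2}X\right)|u|^{p}\,dx=\frac1p\int_{\Omega}A\,\mathcal{R}_{p}\left(\left(\frac{G}{H}\right)^{\frac{1}{p^{2}}}uX,\ \left(\frac{H}{G}\right)^{\frac{p-1}{p^{2}}}\nabla u\right)dx$$ and $$G_X^{\frac1p}H^{\frac{p-1}{p}}+\frac1p\int_{\Omega}\operatorname{div}\left(A|X|^{p-2}X\right)|u|^{p}\,dx=\frac1p\int_{\Omega}A\,\mathcal{R}_{p}\left(\left(\frac{G_X}{H}\right)^{\frac{1}{p^{2}}}u|X|,\ \left(\frac{H}{G_X}\right)^{\frac{p-1}{p^{2}}}\frac{X}{|X|}\cdot\nabla u\right)dx.$$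
   Context: $C_0^1(\Omega)$ denotes the space of $C^1$ functions with compact support in $\Omega$. For $p>1$, $n\ge 1$ and vectors $a,b\in\mathbb{R}^n$, $$\mathcal{R}_p(a,b)=|b|^p+(p-1)|a|^p-p|a|^{p-2}a\cdot b.$$ In the first identity $\mathcal{R}_p$ is applied to vectors in $\mathbb{R}^N$; in the second its arguments are scalars ($n=1$). *)

theory Defs
  imports "HOL-Analysis.Analysis"
begin

definition C1_on :: "'a::euclidean_space set \<Rightarrow> ('a \<Rightarrow> 'b::real_normed_vector) \<Rightarrow> bool" where
  "C1_on S f \<longleftrightarrow>
    (\<exists>f' :: 'a \<Rightarrow> 'a \<Rightarrow>\<^sub>L 'b.
      (\<forall>x\<in>S. (f has_derivative blinfun_apply (f' x)) (at x)) \<and> continuous_on S f')"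

(* C^1 functions whose support is a compact subset of S. Functions are total here, but only
   their values on the open set S matter. *)
definition C1_compact_support_on :: "'a::euclidean_space set \<Rightarrow> ('a \<Rightarrow> real) \<Rightarrow> bool" where
  "C1_compact_support_on S u \<longleftrightarrow>
    C1_on S u \<and> compact (closure (support_on S u)) \<and> closure (support_on S u) \<subseteq> S"

definition grad :: "('a::euclidean_space \<Rightarrow> real) \<Rightarrow> 'a \<Rightarrow> 'a" where
  "grad u x = (\<Sum>i\<in>Basis. frechet_derivative u (at x) i *\<^sub>R i)"

definition divergence :: "('a::euclidean_space \<Rightarrow> 'a) \<Rightarrow> 'a \<Rightarrow> real" where
  "divergence F x = (\<Sum>i\<in>Basis. frechet_derivative F (at x) i \<bullet> i)"

(* Since 0 powr r = 0, the product |a|^(p-2) (a . b) is 0 at a = 0, also for p < 2.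
   For n = 1 the type is real, where the inner product is multiplication and the norm
   is the absolute value. *)
definition R_p :: "real \<Rightarrow> 'v::real_inner \<Rightarrow> 'v \<Rightarrow> real" where
  "R_p p a b = norm b powr p + (p - 1) * norm a powr p - p * norm a powr (p - 2) * (a \<bullet> b)"

(* The integral of (div F) * phi over S. For a C^1 field F it is the integral of the classical
   divergence. The field F = A |X|^(p-2) X is C^1 if p >= 2 or if X has no zeros; for 1 < p < 2 it
   is in general only continuous at the zeros of X. The last two cases concern such fields only:
   - if F is C^1 off its zeros with locally integrable derivative there, then the classical
     divergence off the zeros, extended by 0, is the (weak) divergence of F, and it is this
     function that is integrated (e.g. F x = |x|^(p-2) x on the whole space);
   - otherwise div F need not be a function, and the value is that of the distribution
     div F at phi. *)
definition integral_div_times ::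
    "'a::euclidean_space set \<Rightarrow> ('a \<Rightarrow> 'a) \<Rightarrow> ('a \<Rightarrow> real) \<Rightarrow> real" where
  "integral_div_times S F \<phi> =
    (if C1_on S F then (LINT x:S|lborel. divergence F x * \<phi> x)
     else if continuous_on S F \<and> C1_on {x\<in>S. F x \<noteq> 0} F \<and>
          (\<forall>K. compact K \<and> K \<subseteq> S \<longrightarrow>
            set_integrable lborel {x\<in>K. F x \<noteq> 0} (\<lambda>x. onorm (frechet_derivative F (at x))))
       then (LINT x:{x\<in>S. F x \<noteq> 0}|lborel. divergence F x * \<phi> x)
     else - (LINT x:S|lborel. F x \<bullet> grad \<phi> x))"

end

theory Submission
  imports Defs
begin

text \<open>
  Write \<open>F = A |X|^(p-2) X\<close> and consider the pair \<open>a = u X\<close>, \<open>b = grad u\<close> for the first identity,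
  and the scalars \<open>a = u |X|\<close>, \<open>b = (X / |X|) \<bullet> grad u\<close> for the second. In both cases the integral
  of \<open>A |a|^p\<close> is \<open>H\<close>, and the cross term \<open>A |a|^(p-2) a \<bullet> b\<close> equals
  \<open>|u|^(p-2) u (F \<bullet> grad u)\<close>, which is \<open>1/p\<close> times \<open>F \<bullet> grad |u|^p\<close>. Two independent facts
  then give the identities.

  The first is algebraic (\<open>integral_R_p_balanced\<close>). The integral of \<open>A R_p (\<alpha> a) (\<beta> b)\<close> is a
  combination of the two energies and the cross term \<open>C\<close>, and the powers of \<open>G / H\<close> in the statement
  are chosen so that the coefficient of \<open>C\<close> is \<open>- p\<close> while both energies become equal to
  \<open>G^(1/p) H^((p-1)/p)\<close>. The degenerate cases \<open>G = 0\<close> and \<open>H = 0\<close> are consistent with division by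
  zero, as \<open>C\<close> vanishes there too.

  The second is integration by parts (\<open>integral_div_times_eq\<close>): the integral of \<open>(div F) |u|^p\<close> is
  minus the integral of \<open>F \<bullet> grad |u|^p\<close>, that is \<open>- p C\<close>. For continuously differentiable fields this
  rests on the fact that a directional derivative of a compactly supported function has integral
  \<open>0\<close>, which follows from translation invariance of Lebesgue measure
  (\<open>integral_directional_derivative_eq_0\<close>). For \<open>p < 2\<close> the field \<open>F\<close> may fail to be differentiable
  at its zeros. If its derivative off the zeros is locally integrable, a cut-off in terms of \<open>|F|^2\<close>
  shows that the zeros contribute nothing (\<open>set_integral_divergence_off_zeros_mult\<close>). In the remaining
  case the divergence is only a distribution, and integration by parts is its definition.
\<close>

section \<open>Calculus of continuously differentiable maps\<close>

lemma C1_on_has_derivative: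
  assumes "C1_on S f" "x \<in> S"
  shows "(f has_derivative frechet_derivative f (at x)) (at x)"
  using assms unfolding C1_on_def by (metis differentiableI frechet_derivative_works)

lemma C1_on_continuous_on_derivative:
  assumes "C1_on S f"
  shows "continuous_on S (\<lambda>x. frechet_derivative f (at x) v)"
proof -
  obtain f' where f': "\<forall>x\<in>S. (f has_derivative blinfun_apply (f' x)) (at x)" "continuous_on S f'"
    using assms unfolding C1_on_def by blast
  have "frechet_derivative f (at x) v = f' x v" if "x \<in> S" for x
    using f'(1) that by (metis frechet_derivative_at)
  moreover have "continuous_on S (\<lambda>x. f' x v)"
    using f'(2) by (intro continuous_intros)
  ultimately show ?thesis
    by (simp cong: continuous_on_cong)
qed

lemma C1_on_continuous_on:
  assumes "C1_on S f"
  shows "continuous_on S f"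
  using C1_on_has_derivative[OF assms]
  by (meson continuous_at_imp_continuous_on has_derivative_continuous)

text \<open>
  Continuity of the derivative in the operator norm reduces to continuity of each directional
  derivative, because the domain has finite dimension.
\<close>

lemma C1_onI:
  fixes f :: "'a::euclidean_space \<Rightarrow> 'b::real_normed_vector"
  assumes deriv: "\<And>x. x \<in> S \<Longrightarrow> (f has_derivative f' x) (at x)"
    and cont: "\<And>v. continuous_on S (\<lambda>x. f' x v)"
  shows "C1_on S f"
  unfolding C1_on_def
proof (intro exI conjI ballI)
  have eq: "blinfun_apply (Blinfun (f' x)) = f' x" if "x \<in> S" for x
    using deriv[OF that] by (simp add: bounded_linear_Blinfun_apply has_derivative_bounded_linear)
  show "(f has_derivative blinfun_apply (Blinfun (f' x))) (at x)" if "x \<in> S" for x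
    using deriv[OF that] eq[OF that] by simp
  show "continuous_on S (\<lambda>x. Blinfun (f' x))"
    by (intro continuous_on_blinfun_componentwise) (use cont eq in \<open>simp cong: continuous_on_cong\<close>)
qed

lemma C1_on_subset: "C1_on S f \<Longrightarrow> T \<subseteq> S \<Longrightarrow> C1_on T f"
  unfolding C1_on_def by (meson continuous_on_subset subsetD)

lemma inner_grad:
  assumes "u differentiable (at x)"
  shows "v \<bullet> grad u x = frechet_derivative u (at x) v"
proof -
  interpret linear "frechet_derivative u (at x)"
    using assms by (rule linear_frechet_derivative)
  have "frechet_derivative u (at x) v = frechet_derivative u (at x) (\<Sum>i\<in>Basis. (v \<bullet> i) *\<^sub>R i)"
    by (simp add: euclidean_representation)
  also have "\<dots> = v \<bullet> grad u x"
    by (simp add: sum scale grad_def inner_sum_right mult.commute)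
  finally show ?thesis ..
qed

lemma inner_grad_eq:
  assumes "(u has_derivative u') (at x)"
  shows "v \<bullet> grad u x = u' v"
  using inner_grad[of u x] assms by (metis differentiableI frechet_derivative_at)

lemma divergence_eq:
  assumes "(F has_derivative F') (at x)"
  shows "divergence F x = (\<Sum>i\<in>Basis. F' i \<bullet> i)"
  unfolding divergence_def using assms by (metis frechet_derivative_at)

lemma continuous_on_grad: "C1_on S u \<Longrightarrow> continuous_on S (grad u)"
  unfolding grad_def[abs_def] by (intro continuous_intros C1_on_continuous_on_derivative)

lemma continuous_on_divergence: "C1_on S F \<Longrightarrow> continuous_on S (divergence F)"
  unfolding divergence_def[abs_def] by (intro continuous_intros C1_on_continuous_on_derivative)

lemma C1_on_compose_real:
  fixes g :: "real \<Rightarrow> real"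
  assumes u: "C1_on S u" and range: "u ` S \<subseteq> T"
    and g: "\<And>t. t \<in> T \<Longrightarrow> (g has_real_derivative g' t) (at t)" "continuous_on T g'"
  shows "C1_on S (\<lambda>x. g (u x))"
    and "x \<in> S \<Longrightarrow> grad (\<lambda>x. g (u x)) x = g' (u x) *\<^sub>R grad u x"
proof -
  have D: "((\<lambda>x. g (u x)) has_derivative (\<lambda>v. g' (u x) * frechet_derivative u (at x) v)) (at x)"
    if "x \<in> S" for x
    using has_derivative_compose[OF C1_on_has_derivative[OF u that], of g "(*) (g' (u x))"]
      g(1)[of "u x"] range that by (auto simp: has_field_derivative_def)
  show "C1_on S (\<lambda>x. g (u x))"
  proof (rule C1_onI[OF D])
    show "continuous_on S (\<lambda>x. g' (u x) * frechet_derivative u (at x) v)" for v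
      by (intro continuous_intros C1_on_continuous_on_derivative[OF u]
          continuous_on_compose2[OF g(2) C1_on_continuous_on[OF u] range])
  qed
  assume x: "x \<in> S"
  show "grad (\<lambda>x. g (u x)) x = g' (u x) *\<^sub>R grad u x"
  proof (rule vector_eq_ldot[THEN iffD1], intro allI)
    fix v
    show "v \<bullet> grad (\<lambda>x. g (u x)) x = v \<bullet> g' (u x) *\<^sub>R grad u x"
      using inner_grad_eq[OF D[OF x]] inner_grad_eq[OF C1_on_has_derivative[OF u x]] by simp
  qed
qed

lemma C1_on_scaleR:
  assumes u: "C1_on S u" and F: "C1_on S F"
  shows "C1_on S (\<lambda>x. u x *\<^sub>R F x)"
    and "x \<in> S \<Longrightarrow> divergence (\<lambda>x. u x *\<^sub>R F x) x = u x * divergence F x + F x \<bullet> grad u x"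
proof -
  let ?u' = "\<lambda>x. frechet_derivative u (at x)" and ?F' = "\<lambda>x. frechet_derivative F (at x)"
  have D: "((\<lambda>x. u x *\<^sub>R F x) has_derivative (\<lambda>v. u x *\<^sub>R ?F' x v + ?u' x v *\<^sub>R F x)) (at x)"
    if "x \<in> S" for x
    by (intro has_derivative_scaleR C1_on_has_derivative[OF u that] C1_on_has_derivative[OF F that])
  show "C1_on S (\<lambda>x. u x *\<^sub>R F x)"
    by (rule C1_onI[OF D]) (auto intro!: continuous_intros C1_on_continuous_on_derivative[OF u]
      C1_on_continuous_on_derivative[OF F] C1_on_continuous_on[OF u] C1_on_continuous_on[OF F])
  assume x: "x \<in> S"
  have "divergence (\<lambda>x. u x *\<^sub>R F x) x = (\<Sum>i\<in>Basis. u x * (?F' x i \<bullet> i) + ?u' x i * (F x \<bullet> i))"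
    by (simp add: divergence_eq[OF D[OF x]] inner_add_left)
  also have "\<dots> = u x * divergence F x + (\<Sum>i\<in>Basis. ?u' x i * (F x \<bullet> i))"
    by (simp add: sum.distrib sum_distrib_left divergence_def)
  also have "(\<Sum>i\<in>Basis. ?u' x i * (F x \<bullet> i)) = F x \<bullet> grad u x"
    by (simp add: grad_def inner_sum_right)
  finally show "divergence (\<lambda>x. u x *\<^sub>R F x) x = u x * divergence F x + F x \<bullet> grad u x" .
qed

lemma C1_on_mult:
  fixes u v :: "'a::euclidean_space \<Rightarrow> real"
  assumes u: "C1_on S u" and v: "C1_on S v"
  shows "C1_on S (\<lambda>x. u x * v x)"
    and "x \<in> S \<Longrightarrow> grad (\<lambda>x. u x * v x) x = u x *\<^sub>R grad v x + v x *\<^sub>R grad u x"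
proof -
  let ?u' = "\<lambda>x. frechet_derivative u (at x)" and ?v' = "\<lambda>x. frechet_derivative v (at x)"
  have D: "((\<lambda>x. u x * v x) has_derivative (\<lambda>h. u x * ?v' x h + ?u' x h * v x)) (at x)"
    if "x \<in> S" for x
    by (intro has_derivative_mult C1_on_has_derivative[OF u that] C1_on_has_derivative[OF v that])
  show "C1_on S (\<lambda>x. u x * v x)"
    by (rule C1_onI[OF D]) (auto intro!: continuous_intros C1_on_continuous_on_derivative[OF u]
      C1_on_continuous_on_derivative[OF v] C1_on_continuous_on[OF u] C1_on_continuous_on[OF v])
  assume x: "x \<in> S"
  show "grad (\<lambda>x. u x * v x) x = u x *\<^sub>R grad v x + v x *\<^sub>R grad u x"
  proof (rule vector_eq_ldot[THEN iffD1], intro allI)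
    fix h
    show "h \<bullet> grad (\<lambda>x. u x * v x) x = h \<bullet> (u x *\<^sub>R grad v x + v x *\<^sub>R grad u x)"
      using inner_grad_eq[OF D[OF x]] inner_grad_eq[OF C1_on_has_derivative[OF u x]]
        inner_grad_eq[OF C1_on_has_derivative[OF v x]] by (simp add: inner_add_right)
  qed
qed

lemma C1_on_inner_self:
  fixes F :: "'a::euclidean_space \<Rightarrow> 'b::real_inner"
  assumes F: "C1_on S F"
  shows "C1_on S (\<lambda>x. F x \<bullet> F x)"
    and "x \<in> S \<Longrightarrow> v \<bullet> grad (\<lambda>x. F x \<bullet> F x) x = 2 * (F x \<bullet> frechet_derivative F (at x) v)"
proof -
  let ?F' = "\<lambda>x. frechet_derivative F (at x)"
  have D: "((\<lambda>x. F x \<bullet> F x) has_derivative (\<lambda>v. F x \<bullet> ?F' x v + ?F' x v \<bullet> F x)) (at x)"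
    if "x \<in> S" for x
    by (intro has_derivative_inner C1_on_has_derivative[OF F that])
  show "C1_on S (\<lambda>x. F x \<bullet> F x)"
    by (rule C1_onI[OF D]) (auto intro!: continuous_intros
      C1_on_continuous_on_derivative[OF F] C1_on_continuous_on[OF F])
  show "x \<in> S \<Longrightarrow> v \<bullet> grad (\<lambda>x. F x \<bullet> F x) x = 2 * (F x \<bullet> ?F' x v)"
    by (simp add: inner_grad_eq[OF D] inner_commute)
qed

text \<open>
  The hypothesis \<open>p > 1\<close> is what makes the function \<open>|t|^p\<close> differentiable at the origin. There
  the formula gives the correct value \<open>0\<close>, even for \<open>p < 2\<close>, since \<open>0 powr (p - 2)\<close> is \<open>0\<close>.
\<close>

lemma has_real_derivative_abs_powr:
  fixes p :: real
  assumes "p > 1"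
  shows "((\<lambda>t. \<bar>t\<bar> powr p) has_real_derivative p * (\<bar>t\<bar> powr (p - 2) * t)) (at t)"
proof (cases "t = 0")
  case False
  then have ev: "\<forall>\<^sub>F s in nhds t. \<bar>s\<bar> powr p = (sgn t * s) powr p"
  proof -
    have "\<forall>\<^sub>F s in nhds t. sgn t * s > 0"
      using False
      by (intro order_tendstoD(1)[of _ "sgn t * t"] tendsto_intros filterlim_ident)
        (auto simp: sgn_if)
    then show ?thesis
      by eventually_elim (auto simp: sgn_if zero_less_mult_iff split: if_splits)
  qed
  have "sgn t * t > 0" using False by (auto simp: sgn_if)
  then have "((\<lambda>s. (sgn t * s) powr p) has_real_derivative p * (sgn t * t) powr (p - 1) * sgn t) (at t)"
    by (auto intro!: derivative_eq_intros)
  moreover have "p * (sgn t * t) powr (p - 1) * sgn t = p * (\<bar>t\<bar> powr (p - 2) * t)"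
  proof -
    have "\<bar>t\<bar> powr (p - 1) = \<bar>t\<bar> powr (p - 2) * \<bar>t\<bar>"
      using False powr_mult_base[of "\<bar>t\<bar>" "p - 2"] by (simp add: mult.commute)
    then show ?thesis
      by (auto simp: sgn_if)
  qed
  ultimately show ?thesis
    using DERIV_cong_ev[OF refl ev refl] by metis
next
  case True
  have "((\<lambda>h. \<bar>h\<bar> powr p / h) \<longlongrightarrow> 0) (at 0)"
  proof (rule Lim_null_comparison)
    show "\<forall>\<^sub>F h in at 0. norm (\<bar>h\<bar> powr p / h) \<le> \<bar>h\<bar> powr (p - 1)"
      by (intro always_eventually) (auto simp: powr_diff abs_mult divide_simps)
    show "((\<lambda>h::real. \<bar>h\<bar> powr (p - 1)) \<longlongrightarrow> 0) (at 0)"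
      using assms by (intro tendsto_zero_powrI tendsto_rabs_zero tendsto_intros) auto
  qed
  then show ?thesis
    using True by (simp add: has_field_derivative_iff)
qed

lemma continuous_on_abs_powr_mult:
  fixes p :: real
  assumes "p > 1"
  shows "continuous_on UNIV (\<lambda>t. p * (\<bar>t\<bar> powr (p - 2) * t))"
proof -
  have "\<bar>t\<bar> powr (p - 2) * t = sgn t * \<bar>t\<bar> powr (p - 1)" for t :: real
    using powr_mult_base[of "\<bar>t\<bar>" "p - 2"] by (cases "t = 0") (auto simp: sgn_if mult.commute)
  moreover have "isCont (\<lambda>t::real. sgn t * \<bar>t\<bar> powr (p - 1)) t" for t
  proof (cases "t = 0")
    case False
    then show ?thesis by (intro continuous_intros) auto
  next
    case True
    have "((\<lambda>t. sgn t * \<bar>t\<bar> powr (p - 1)) \<longlongrightarrow> 0) (at (0::real))"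
    proof (rule Lim_null_comparison)
      show "\<forall>\<^sub>F t in at 0. norm (sgn t * \<bar>t\<bar> powr (p - 1)) \<le> \<bar>t\<bar> powr (p - 1)"
        by (intro always_eventually) (auto simp: abs_mult sgn_if)
      show "((\<lambda>h::real. \<bar>h\<bar> powr (p - 1)) \<longlongrightarrow> 0) (at 0)"
        using assms by (intro tendsto_zero_powrI tendsto_rabs_zero tendsto_intros) auto
    qed
    then show ?thesis using True by (simp add: isCont_def)
  qed
  ultimately show ?thesis
    by (simp add: continuous_at_imp_continuous_on continuous_on_mult_left)
qed

section \<open>Integration by parts against a compactly supported function\<close>

lemma set_integrable_of_compact_support:
  fixes f :: "'a::euclidean_space \<Rightarrow> 'b::euclidean_space"
  assumes S: "open S" and f: "continuous_on S f" and K: "compact K" "K \<subseteq> S"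
    and zero: "\<And>x. x \<in> S - K \<Longrightarrow> f x = 0"
  shows "set_integrable lborel S f"
proof -
  have "integrable lborel (\<lambda>x. indicator K x *\<^sub>R f x)"
    using borel_integrable_compact[OF K(1) continuous_on_subset[OF f K(2)]]
    by (simp add: if_distrib indicator_def cong: if_cong)
  also have "(\<lambda>x. indicator K x *\<^sub>R f x) = (\<lambda>x. indicator S x *\<^sub>R f x)"
    using zero K(2) by (auto simp: indicator_def fun_eq_iff)
  finally show ?thesis
    by (simp add: set_integrable_def)
qed

text \<open>
  Lebesgue measure is translation invariant, so every difference quotient of \<open>g\<close> has integral
  \<open>0\<close>. The quotients converge pointwise to the directional derivative, and they are dominated
  because \<open>g\<close> is Lipschitz and its translates by at most \<open>v\<close> vanish off one fixed ball.
\<close>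

lemma integral_directional_derivative_eq_0:
  fixes g :: "'a::euclidean_space \<Rightarrow> real"
  assumes deriv: "\<And>x. (g has_derivative blinfun_apply (g' x)) (at x)"
    and cont: "continuous_on UNIV g'"
    and K: "compact K" and zero: "\<And>x. x \<notin> K \<Longrightarrow> g x = 0"
  shows "integral\<^sup>L lborel (\<lambda>x. g' x v) = 0"
proof -
  have g_cont: "continuous_on UNIV g"
    using deriv by (meson continuous_at_imp_continuous_on has_derivative_continuous)
  have g'_zero: "g' x = 0" if "x \<notin> K" for x
  proof -
    have "open (- K)" "x \<in> - K" using K that by (auto simp: compact_imp_closed)
    then have "(g has_derivative (\<lambda>_. 0)) (at x)"
      by (rule has_derivative_transform_within_open[OF has_derivative_const[of 0]])
        (use zero in auto)
    then have "blinfun_apply (g' x) = (\<lambda>_. 0)"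
      using deriv by (metis has_derivative_unique)
    then show ?thesis by (simp add: blinfun_eqI)
  qed
  have "bounded (g' ` K)"
    by (intro compact_imp_bounded compact_continuous_image K continuous_on_subset[OF cont]) auto
  then obtain B where B: "\<And>x. x \<in> K \<Longrightarrow> norm (g' x) \<le> B" "B > 0"
    by (auto simp: bounded_pos)
  have B': "norm (g' x) \<le> B" for x
    using B g'_zero[of x] by (cases "x \<in> K") auto
  have Lip: "\<bar>g x - g y\<bar> \<le> B * norm (x - y)" for x y
    using differentiable_bound[of UNIV g "\<lambda>x. blinfun_apply (g' x)" B x y] deriv B'
    by (auto simp: norm_blinfun.rep_eq[symmetric])
  have g_int: "integrable lborel g"
    using set_integrable_of_compact_support[OF open_UNIV g_cont K] zero
    by (simp add: set_integrable_def)
  have shift: "integrable lborel (\<lambda>x. g (h + x))" "integral\<^sup>L lborel (\<lambda>x. g (h + x)) = integral\<^sup>L lborel g"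
    for h
  proof -
    have g_meas: "g \<in> borel_measurable borel"
      using g_cont by (rule borel_measurable_continuous_onI)
    show "integrable lborel (\<lambda>x. g (h + x))"
      using g_int integrable_distr_eq[of "(+) h" lborel borel g] g_meas
      by (simp add: lborel_distr_plus)
    show "integral\<^sup>L lborel (\<lambda>x. g (h + x)) = integral\<^sup>L lborel g"
      using integral_distr[of "(+) h" lborel borel g] g_meas by (simp add: lborel_distr_plus)
  qed
  define s where "s n x = real (Suc n) * (g (v /\<^sub>R real (Suc n) + x) - g x)" for n x
  have s_int: "integral\<^sup>L lborel (s n) = 0" for n
    unfolding s_def using shift g_int by simp
  obtain r where r: "\<And>x. x \<in> K \<Longrightarrow> norm x \<le> r"
    using compact_imp_bounded[OF K] by (auto simp: bounded_iff)
  define w where "w x = indicator (cball 0 (r + norm v)) x *\<^sub>R (B * norm v)" for x :: 'a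
  have "(\<lambda>n. integral\<^sup>L lborel (s n)) \<longlonglongrightarrow> integral\<^sup>L lborel (\<lambda>x. g' x v)"
  proof (rule integral_dominated_convergence)
    show "(\<lambda>x. g' x v) \<in> borel_measurable lborel"
      using cont by (auto intro!: borel_measurable_continuous_onI continuous_intros)
    show "s n \<in> borel_measurable lborel" for n
      unfolding s_def using shift(1) g_int by (intro borel_measurable_integrable) auto
    show "integrable lborel w"
      unfolding w_def by (intro integrable_indicator) (use emeasure_bounded_finite[of "cball 0 (r + norm v)"] in auto)
    show "AE x in lborel. (\<lambda>n. s n x) \<longlonglongrightarrow> g' x v"
    proof (intro AE_I2)
      fix x
      have "((\<lambda>t. g (x + t *\<^sub>R v)) has_derivative (\<lambda>t. g' x (t *\<^sub>R v))) (at 0)"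
        by (rule has_derivative_compose[where g = g and f = "\<lambda>t. x + t *\<^sub>R v"])
          (auto intro!: derivative_eq_intros deriv)
      then have "((\<lambda>t. g (x + t *\<^sub>R v)) has_real_derivative g' x v) (at 0)"
        by (simp add: has_field_derivative_def blinfun.scaleR_right mult_commute_abs)
      then have "((\<lambda>t. (g (x + t *\<^sub>R v) - g x) / t) \<longlongrightarrow> g' x v) (at 0)"
        by (simp add: has_field_derivative_iff)
      moreover have "filterlim (\<lambda>n. inverse (real (Suc n))) (at 0) sequentially"
        using LIMSEQ_inverse_real_of_nat by (auto simp: filterlim_at)
      ultimately have "(\<lambda>n. (g (x + inverse (real (Suc n)) *\<^sub>R v) - g x) / inverse (real (Suc n)))
          \<longlonglongrightarrow> g' x v"
        by (rule filterlim_compose)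
      then show "(\<lambda>n. s n x) \<longlonglongrightarrow> g' x v"
        by (simp add: s_def field_simps add.commute)
    qed
    show "AE x in lborel. norm (s n x) \<le> w x" for n
    proof (intro AE_I2)
      fix x
      show "norm (s n x) \<le> w x"
      proof (cases "x \<in> cball 0 (r + norm v)")
        case True
        have "norm (s n x) \<le> real (Suc n) * (B * norm (v /\<^sub>R real (Suc n)))"
          unfolding s_def real_norm_def abs_mult
          using Lip[of "v /\<^sub>R real (Suc n) + x" x] by (intro mult_mono) auto
        also have "\<dots> = B * norm v" by simp
        finally show ?thesis using True by (simp add: w_def)
      next
        case False
        have small: "norm (v /\<^sub>R real (Suc n)) \<le> norm v"
          using mult_nonneg_nonneg[of "norm v" "real n"] by (simp add: divide_simps algebra_simps)
        have "x \<notin> K" using False r[of x] norm_ge_zero[of v] by auto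
        moreover have "v /\<^sub>R real (Suc n) + x \<notin> K"
          using False r[of "v /\<^sub>R real (Suc n) + x"] small
            norm_triangle_ineq4[of "v /\<^sub>R real (Suc n) + x" "v /\<^sub>R real (Suc n)"] by auto
        ultimately show ?thesis using zero B(2) by (simp add: s_def w_def indicator_def)
      qed
    qed
  qed
  then show ?thesis
    by (simp add: s_int LIMSEQ_const_iff)
qed

text \<open>
  Extended by zero, \<open>F\<close> is continuously differentiable on the whole space, and each summand of
  its divergence is a directional derivative of a compactly supported function.
\<close>

lemma set_integral_divergence_eq_0:
  fixes F :: "'a::euclidean_space \<Rightarrow> 'a"
  assumes S: "open S" and F: "C1_on S F" and K: "compact K" "K \<subseteq> S"
    and zero: "\<And>x. x \<in> S - K \<Longrightarrow> F x = 0"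
  shows "(LINT x:S|lborel. divergence F x) = 0"
proof -
  obtain F' where F': "\<And>x. x \<in> S \<Longrightarrow> (F has_derivative blinfun_apply (F' x)) (at x)"
    and F'_cont: "continuous_on S F'"
    using F unfolding C1_on_def by blast
  define W where "W x = (if x \<in> S then F x else 0)" for x
  define W' where "W' x = (if x \<in> S then F' x else 0)" for x
  have open_K: "open (- K)" using K by (simp add: compact_imp_closed open_Compl)
  have W_zero: "(W has_derivative (\<lambda>_. 0)) (at x)" if "x \<in> - K" for x
    by (rule has_derivative_transform_within_open[OF has_derivative_const[of 0] open_K that])
      (use zero in \<open>auto simp: W_def\<close>)
  have W_deriv: "(W has_derivative blinfun_apply (W' x)) (at x)" for x
  proof (cases "x \<in> S")
    case True
    have "(W has_derivative blinfun_apply (F' x)) (at x)"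
      by (rule has_derivative_transform_within_open[OF F'[OF True] S True]) (simp add: W_def)
    then show ?thesis using True by (simp add: W'_def)
  next
    case False
    then have "x \<in> - K" using K by auto
    then show ?thesis using False W_zero[of x] by (simp add: W'_def zero_blinfun.rep_eq)
  qed
  have W'_zero: "W' x = 0" if "x \<in> - K" for x
    using has_derivative_unique[OF W_deriv W_zero[OF that]] by (simp add: blinfun_eqI)
  have "continuous_on (S \<union> - K) W'"
  proof (rule continuous_on_open_Un[OF S open_K])
    show "continuous_on S W'" using F'_cont by (simp add: W'_def cong: continuous_on_cong)
    show "continuous_on (- K) W'"
      using continuous_on_const[of "- K" 0] W'_zero continuous_on_cong[of "- K" "- K" W' "\<lambda>_. 0"] by simp
  qed
  moreover have "S \<union> - K = UNIV" using K by auto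
  ultimately have W'_cont: "continuous_on UNIV W'" by simp
  have comp: "integral\<^sup>L lborel (\<lambda>x. W' x i \<bullet> i) = 0" "integrable lborel (\<lambda>x. W' x i \<bullet> i)" for i
  proof -
    have D: "((\<lambda>x. W x \<bullet> i) has_derivative blinfun_apply (blinfun_inner_left i o\<^sub>L W' x)) (at x)" for x
    proof -
      have "blinfun_apply (blinfun_inner_left i o\<^sub>L W' x) = (\<lambda>v. W' x v \<bullet> i)"
        by (simp add: fun_eq_iff inner_commute)
      then show ?thesis
        using has_derivative_inner_left[OF W_deriv[of x], of i] by simp
    qed
    have "continuous_on UNIV (\<lambda>x. blinfun_inner_left i o\<^sub>L W' x)"
      using W'_cont by (intro continuous_intros)
    from integral_directional_derivative_eq_0[OF D this K(1), of i]
    show "integral\<^sup>L lborel (\<lambda>x. W' x i \<bullet> i) = 0"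
      using K zero by (auto simp: W_def)
    have "set_integrable lborel UNIV (\<lambda>x. W' x i \<bullet> i)"
      using W'_cont W'_zero
      by (intro set_integrable_of_compact_support[OF _ _ K(1)] continuous_intros) auto
    then show "integrable lborel (\<lambda>x. W' x i \<bullet> i)"
      by (simp add: set_integrable_def)
  qed
  have "indicator S x *\<^sub>R divergence F x = (\<Sum>i\<in>Basis. W' x i \<bullet> i)" for x
    by (auto simp: indicator_def W'_def divergence_eq[OF F'])
  then have "(LINT x:S|lborel. divergence F x) = integral\<^sup>L lborel (\<lambda>x. \<Sum>i\<in>Basis. W' x i \<bullet> i)"
    by (simp add: set_lebesgue_integral_def)
  also have "\<dots> = 0"
    using comp by (subst Bochner_Integration.integral_sum) auto
  finally show ?thesis .
qed

lemma grad_eq_0_off_support: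
  assumes "open S" "closed K" "\<And>x. x \<in> S - K \<Longrightarrow> u x = 0" "x \<in> S - K"
  shows "grad u x = 0"
proof -
  have "open (S - K)" using assms by auto
  then have "(u has_derivative (\<lambda>_. 0)) (at x)"
    by (rule has_derivative_transform_within_open[OF has_derivative_const[of 0] _ assms(4)])
      (use assms(3) in auto)
  then show ?thesis
    unfolding grad_def by (metis (no_types, lifting) frechet_derivative_at scaleR_zero_left sum.neutral)
qed

text \<open>
  The field \<open>\<phi> F\<close> has compact support, so its divergence
  \<open>\<phi> div F + F \<bullet> grad \<phi>\<close> integrates to \<open>0\<close>.
\<close>

lemma set_integral_divergence_mult:
  fixes F :: "'a::euclidean_space \<Rightarrow> 'a"
  assumes S: "open S" and F: "C1_on S F" and \<phi>: "C1_on S \<phi>" and K: "compact K" "K \<subseteq> S"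
    and zero: "\<And>x. x \<in> S - K \<Longrightarrow> \<phi> x = 0"
  shows "(LINT x:S|lborel. divergence F x * \<phi> x) = - (LINT x:S|lborel. F x \<bullet> grad \<phi> x)"
proof -
  have int1: "set_integrable lborel S (\<lambda>x. divergence F x * \<phi> x)"
    using zero by (intro set_integrable_of_compact_support[OF S _ K] continuous_intros
        continuous_on_divergence F C1_on_continuous_on \<phi>) auto
  have int2: "set_integrable lborel S (\<lambda>x. F x \<bullet> grad \<phi> x)"
    using grad_eq_0_off_support[OF S compact_imp_closed[OF K(1)] zero]
    by (intro set_integrable_of_compact_support[OF S _ K] continuous_intros
        continuous_on_grad F C1_on_continuous_on \<phi>) auto
  have "0 = (LINT x:S|lborel. divergence (\<lambda>x. \<phi> x *\<^sub>R F x) x)"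
    using set_integral_divergence_eq_0[OF S C1_on_scaleR(1)[OF \<phi> F] K] zero by simp
  also have "\<dots> = (LINT x:S|lborel. divergence F x * \<phi> x + F x \<bullet> grad \<phi> x)"
    using S by (intro set_lebesgue_integral_cong) (auto simp: C1_on_scaleR(2)[OF \<phi> F])
  also have "\<dots> = (LINT x:S|lborel. divergence F x * \<phi> x) + (LINT x:S|lborel. F x \<bullet> grad \<phi> x)"
    using int1 int2 by (rule set_integral_add)
  finally show ?thesis by simp
qed

section \<open>Fields that are only continuous at their zeros\<close>

text \<open>
  A continuously differentiable function of \<open>s > 0\<close> that vanishes for \<open>s \<le> \<epsilon>\<close>
  and increases to \<open>1\<close> as \<open>\<epsilon>\<close> tends to \<open>0\<close>. It is applied to \<open>s = |F|^2\<close>, to keep test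
  functions away from the zeros of a field \<open>F\<close>. It is a function of \<open>\<epsilon> / s\<close> alone,
  so that \<open>s\<close> times its derivative is bounded uniformly in \<open>\<epsilon>\<close>.
\<close>

definition cutoff :: "real \<Rightarrow> real \<Rightarrow> real" where
  "cutoff \<epsilon> s = (max 0 (1 - \<epsilon> / s))\<^sup>2"

definition cutoff_deriv :: "real \<Rightarrow> real \<Rightarrow> real" where
  "cutoff_deriv \<epsilon> s = 2 * max 0 (1 - \<epsilon> / s) * (\<epsilon> / s\<^sup>2)"

lemma has_real_derivative_max_0_sq:
  "((\<lambda>t. (max 0 t)\<^sup>2) has_real_derivative 2 * max 0 t) (at (t::real))"
proof -
  consider "t < 0" | "t = 0" | "t > 0" by linarith
  then show ?thesis
  proof cases
    case 1
    have "((\<lambda>t. 0) has_real_derivative 0) (at t)" by simp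
    then have "((\<lambda>t. (max 0 t)\<^sup>2) has_real_derivative 0) (at t)"
      by (rule has_field_derivative_transform_within_open[where S = "{..<0}"]) (use 1 in auto)
    then show ?thesis using 1 by simp
  next
    case 2
    have "((\<lambda>h::real. (max 0 h)\<^sup>2 / h) \<longlongrightarrow> 0) (at 0)"
    proof (rule Lim_null_comparison)
      show "\<forall>\<^sub>F h::real in at 0. norm ((max 0 h)\<^sup>2 / h) \<le> \<bar>h\<bar>"
        by (intro always_eventually) (auto simp: max_def power2_eq_square)
      show "((\<lambda>h::real. \<bar>h\<bar>) \<longlongrightarrow> 0) (at 0)"
        by (intro tendsto_rabs_zero tendsto_intros)
    qed
    then show ?thesis using 2 by (simp add: has_field_derivative_iff)
  next
    case 3
    have "((\<lambda>t. t\<^sup>2) has_real_derivative 2 * t) (at t)"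
      by (auto intro!: derivative_eq_intros)
    then have "((\<lambda>t. (max 0 t)\<^sup>2) has_real_derivative 2 * t) (at t)"
      by (rule has_field_derivative_transform_within_open[where S = "{0<..}"]) (use 3 in auto)
    then show ?thesis using 3 by simp
  qed
qed

lemma has_real_derivative_cutoff:
  assumes "s > 0"
  shows "(cutoff \<epsilon> has_real_derivative cutoff_deriv \<epsilon> s) (at s)"
proof -
  have "((\<lambda>s. 1 - \<epsilon> / s) has_real_derivative \<epsilon> / s\<^sup>2) (at s)"
    using assms by (auto intro!: derivative_eq_intros simp: power2_eq_square)
  from DERIV_chain2[OF has_real_derivative_max_0_sq this]
  show ?thesis unfolding cutoff_def[abs_def] cutoff_deriv_def .
qed

lemma continuous_on_cutoff_deriv: "continuous_on {0<..} (cutoff_deriv \<epsilon>)"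
  unfolding cutoff_deriv_def[abs_def] by (auto intro!: continuous_intros)

lemma cutoff_nonneg: "0 \<le> cutoff \<epsilon> s"
  by (simp add: cutoff_def)

lemma cutoff_le_1: "0 < \<epsilon> \<Longrightarrow> 0 < s \<Longrightarrow> cutoff \<epsilon> s \<le> 1"
  unfolding cutoff_def by (intro power_le_one) auto

lemma cutoff_eq_0: "0 < s \<Longrightarrow> s \<le> \<epsilon> \<Longrightarrow> cutoff \<epsilon> s = 0"
  by (auto simp: cutoff_def)

lemma cutoff_deriv_bound:
  assumes "0 < \<epsilon>" "0 < s"
  shows "\<bar>cutoff_deriv \<epsilon> s\<bar> * s \<le> 2"
proof -
  define r where "r = \<epsilon> / s"
  have r: "r > 0" using assms by (simp add: r_def)
  have "\<bar>cutoff_deriv \<epsilon> s\<bar> * s = 2 * (max 0 (1 - r) * r)"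
    using assms r by (simp add: cutoff_deriv_def r_def abs_mult power2_eq_square)
  also have "max 0 (1 - r) * r \<le> 1"
    using r by (cases "r \<le> 1") (auto simp: max_def intro!: mult_le_one)
  finally show ?thesis by simp
qed

lemma cutoff_tendsto:
  assumes "0 < s" "\<epsilon> \<longlonglongrightarrow> 0"
  shows "(\<lambda>n. cutoff (\<epsilon> n) s) \<longlonglongrightarrow> 1" "(\<lambda>n. cutoff_deriv (\<epsilon> n) s) \<longlonglongrightarrow> 0"
proof -
  have "(\<lambda>n. cutoff (\<epsilon> n) s) \<longlonglongrightarrow> (max 0 (1 - 0 / s))\<^sup>2"
    unfolding cutoff_def using assms by (intro tendsto_intros) auto
  then show "(\<lambda>n. cutoff (\<epsilon> n) s) \<longlonglongrightarrow> 1" by simp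
  have "(\<lambda>n. cutoff_deriv (\<epsilon> n) s) \<longlonglongrightarrow> 2 * max 0 (1 - 0 / s) * (0 / s\<^sup>2)"
    unfolding cutoff_deriv_def using assms by (intro tendsto_intros) auto
  then show "(\<lambda>n. cutoff_deriv (\<epsilon> n) s) \<longlonglongrightarrow> 0" by simp
qed

lemma abs_divergence_le:
  fixes F :: "'a::euclidean_space \<Rightarrow> 'a"
  assumes "C1_on S F" "x \<in> S"
  shows "\<bar>divergence F x\<bar> \<le> DIM('a) * onorm (frechet_derivative F (at x))"
proof -
  let ?F' = "frechet_derivative F (at x)"
  have lin: "bounded_linear ?F'"
    using C1_on_has_derivative[OF assms] by (rule has_derivative_bounded_linear)
  have "\<bar>?F' i \<bullet> i\<bar> \<le> onorm ?F'" if "i \<in> Basis" for i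
    using Cauchy_Schwarz_ineq2[of "?F' i" i] onorm[OF lin, of i] that by auto
  then have "(\<Sum>i\<in>Basis. \<bar>?F' i \<bullet> i\<bar>) \<le> DIM('a) * onorm ?F'"
    using sum_mono[of Basis "\<lambda>i. \<bar>?F' i \<bullet> i\<bar>" "\<lambda>_. onorm ?F'"] by simp
  then show ?thesis
    unfolding divergence_def by (rule order_trans[OF sum_abs])
qed

lemma set_borel_measurable_lborel_continuous_on:
  fixes f :: "'a::euclidean_space \<Rightarrow> 'b::euclidean_space"
  assumes "open S" "continuous_on S f"
  shows "set_borel_measurable lborel S f"
  using set_measurable_continuous_on[of S f] assms by (simp add: set_borel_measurable_def)

text \<open>
  On the open set \<open>U\<close> where \<open>F\<close> does not vanish, the test function \<open>\<phi>\<close> need not be compactly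
  supported, but \<open>cutoff \<epsilon> (|F|^2) \<phi>\<close> is, and integration by parts is available for it. As
  \<open>\<epsilon>\<close> tends to \<open>0\<close>, the only term without an obvious limit is
  \<open>\<phi> cutoff' \<epsilon> (|F|^2) (F \<bullet> grad |F|^2)\<close>. It tends to \<open>0\<close> pointwise, and since
  \<open>|F \<bullet> grad |F|^2|\<close> is at most \<open>2 |F|^2 |DF|\<close>, the uniform bound on \<open>s cutoff' \<epsilon> s\<close> dominates it
  by a multiple of \<open>|DF|\<close>, which is integrable on the support of \<open>\<phi>\<close>.
\<close>

lemma set_integral_divergence_off_zeros_mult:
  fixes F :: "'a::euclidean_space \<Rightarrow> 'a"
  assumes S: "open S" and F: "continuous_on S F" and \<phi>: "C1_on S \<phi>" and K: "compact K" "K \<subseteq> S"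
    and zero: "\<And>x. x \<in> S - K \<Longrightarrow> \<phi> x = 0"
    and F1: "C1_on {x\<in>S. F x \<noteq> 0} F"
    and int: "set_integrable lborel {x\<in>K. F x \<noteq> 0} (\<lambda>x. onorm (frechet_derivative F (at x)))"
  shows "(LINT x:{x\<in>S. F x \<noteq> 0}|lborel. divergence F x * \<phi> x) = - (LINT x:S|lborel. F x \<bullet> grad \<phi> x)"
proof -
  define U where "U = {x\<in>S. F x \<noteq> 0}"
  define N where "N x = onorm (frechet_derivative F (at x))" for x
  define \<epsilon> where "\<epsilon> n = inverse (real (Suc n))" for n
  have \<epsilon>: "\<epsilon> n > 0" "\<epsilon> \<longlonglongrightarrow> 0" for n
    unfolding \<epsilon>_def using LIMSEQ_inverse_real_of_nat by auto
  have U: "open U"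
  proof -
    have "U = S \<inter> F -` (- {0})" by (auto simp: U_def)
    then show ?thesis using continuous_open_preimage[OF F S, of "- {0}"] by auto
  qed
  have F1: "C1_on U F" using F1 by (simp add: U_def)
  have \<phi>U: "C1_on U \<phi>" using \<phi> by (rule C1_on_subset) (auto simp: U_def)
  define q where "q x = F x \<bullet> F x" for x
  have q: "C1_on U q" "\<And>x. x \<in> U \<Longrightarrow> q x > 0"
    unfolding q_def using C1_on_inner_self(1)[OF F1] by (auto simp: U_def)
  have q_grad: "\<bar>F x \<bullet> grad q x\<bar> \<le> 2 * N x * q x" if "x \<in> U" for x
  proof -
    have lin: "bounded_linear (frechet_derivative F (at x))"
      using C1_on_has_derivative[OF F1 that] by (rule has_derivative_bounded_linear)
    have "\<bar>F x \<bullet> frechet_derivative F (at x) (F x)\<bar> \<le> norm (F x) * (N x * norm (F x))"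
      unfolding N_def
      by (rule order_trans[OF Cauchy_Schwarz_ineq2 mult_left_mono[OF onorm[OF lin]]]) simp
    also have "\<dots> = N x * q x"
      by (simp add: q_def power2_norm_eq_inner[symmetric] power2_eq_square)
    finally show ?thesis
      unfolding q_def using C1_on_inner_self(2)[OF F1 that, of "F x"] by (simp add: abs_mult)
  qed
  define h where "h n x = cutoff (\<epsilon> n) (q x)" for n x
  have h: "C1_on U (h n)" "\<And>x. x \<in> U \<Longrightarrow> grad (h n) x = cutoff_deriv (\<epsilon> n) (q x) *\<^sub>R grad q x" for n
    using C1_on_compose_real[OF q(1), of "{0<..}" "cutoff (\<epsilon> n)" "cutoff_deriv (\<epsilon> n)"]
      q(2) has_real_derivative_cutoff continuous_on_cutoff_deriv
    unfolding h_def by (auto simp: image_subset_iff)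
  have h_range: "0 \<le> h n x" "x \<in> U \<Longrightarrow> h n x \<le> 1" for n x
    unfolding h_def using cutoff_nonneg cutoff_le_1 \<epsilon> q by auto
  have \<phi>_cont: "continuous_on S \<phi>" using \<phi> by (rule C1_on_continuous_on)
  have "bounded (\<phi> ` K)"
    by (intro compact_imp_bounded compact_continuous_image K continuous_on_subset[OF \<phi>_cont])
  then obtain B where B: "\<And>x. x \<in> K \<Longrightarrow> \<bar>\<phi> x\<bar> \<le> B" "B > 0"
    by (auto simp: bounded_pos)
  have N_nonneg: "N x \<ge> 0" if "x \<in> U" for x
    unfolding N_def
    using C1_on_has_derivative[OF F1 that] by (intro onorm_pos_le has_derivative_bounded_linear)
  have N_int: "integrable lborel (\<lambda>x. indicator {x\<in>K. F x \<noteq> 0} x *\<^sub>R N x)"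
    using int by (simp add: set_integrable_def N_def)
  have UK: "x \<in> {x\<in>K. F x \<noteq> 0}" if "x \<in> U" "\<phi> x \<noteq> 0" for x
    using that zero by (auto simp: U_def)
  have parts: "(LINT x:U|lborel. divergence F x * (h n x * \<phi> x)) =
      - (LINT x:U|lborel. F x \<bullet> grad (\<lambda>x. h n x * \<phi> x) x)" for n
  proof (rule set_integral_divergence_mult[OF U F1 C1_on_mult(1)[OF h(1) \<phi>U]])
    \<comment> \<open>A compact set that contains the support of the cut-off test function and has
      positive distance from the zeros of \<open>F\<close>.\<close>
    let ?K = "K \<inter> {x\<in>S. \<epsilon> n \<le> q x}"
    have "closed (K \<inter> q -` {\<epsilon> n..})"
      using K unfolding q_def
      by (intro continuous_closed_preimage continuous_intros continuous_on_subset[OF F])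
        (auto simp: compact_imp_closed)
    moreover have "?K = K \<inter> (K \<inter> q -` {\<epsilon> n..})" using K by auto
    ultimately show "compact ?K" using K by (metis compact_Int_closed)
    show "?K \<subseteq> U" using \<epsilon>(1)[of n] by (auto simp: U_def q_def)
    show "h n x * \<phi> x = 0" if "x \<in> U - ?K" for x
      using that zero[of x] cutoff_eq_0[OF q(2)[of x], of "\<epsilon> n"] by (auto simp: h_def U_def)
  qed
  have lim1: "(\<lambda>n. LINT x:U|lborel. divergence F x * (h n x * \<phi> x)) \<longlonglongrightarrow>
      (LINT x:U|lborel. divergence F x * \<phi> x)"
    unfolding set_lebesgue_integral_def
  proof (rule integral_dominated_convergence)
    show "(\<lambda>x. indicator U x *\<^sub>R (divergence F x * \<phi> x)) \<in> borel_measurable lborel"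
      unfolding set_borel_measurable_def[symmetric]
      by (intro set_borel_measurable_lborel_continuous_on[OF U] continuous_intros
          continuous_on_divergence[OF F1] C1_on_continuous_on[OF \<phi>U])
    show "(\<lambda>x. indicator U x *\<^sub>R (divergence F x * (h n x * \<phi> x))) \<in> borel_measurable lborel" for n
      unfolding set_borel_measurable_def[symmetric]
      by (intro set_borel_measurable_lborel_continuous_on[OF U] continuous_intros
          continuous_on_divergence[OF F1] C1_on_continuous_on[OF \<phi>U] C1_on_continuous_on[OF h(1)])
    show "integrable lborel (\<lambda>x. (DIM('a) * B) * (indicator {x\<in>K. F x \<noteq> 0} x *\<^sub>R N x))"
      using N_int by (rule integrable_mult_right)
    show "AE x in lborel. (\<lambda>n. indicator U x *\<^sub>R (divergence F x * (h n x * \<phi> x)))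
        \<longlonglongrightarrow> indicator U x *\<^sub>R (divergence F x * \<phi> x)"
    proof (intro AE_I2)
      fix x
      show "(\<lambda>n. indicator U x *\<^sub>R (divergence F x * (h n x * \<phi> x)))
          \<longlonglongrightarrow> indicator U x *\<^sub>R (divergence F x * \<phi> x)"
      proof (cases "x \<in> U")
        case True
        have "(\<lambda>n. divergence F x * (h n x * \<phi> x)) \<longlonglongrightarrow> divergence F x * (1 * \<phi> x)"
          unfolding h_def by (intro tendsto_intros cutoff_tendsto q True \<epsilon>)
        then show ?thesis using True by simp
      qed simp
    qed
    show "AE x in lborel. norm (indicator U x *\<^sub>R (divergence F x * (h n x * \<phi> x)))
        \<le> (DIM('a) * B) * (indicator {x\<in>K. F x \<noteq> 0} x *\<^sub>R N x)" for n
    proof (intro AE_I2)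
      fix x
      show "norm (indicator U x *\<^sub>R (divergence F x * (h n x * \<phi> x)))
        \<le> (DIM('a) * B) * (indicator {x\<in>K. F x \<noteq> 0} x *\<^sub>R N x)"
      proof (cases "x \<in> U \<and> \<phi> x \<noteq> 0")
        case True
        then have x: "x \<in> U" "x \<in> K" "F x \<noteq> 0" using UK by auto
        have "\<bar>divergence F x\<bar> * (\<bar>h n x\<bar> * \<bar>\<phi> x\<bar>) \<le> (DIM('a) * N x) * (1 * B)"
          using abs_divergence_le[OF F1 x(1)] h_range(1)[of n x] h_range(2)[of x n] x B N_nonneg[of x]
          by (intro mult_mono) (auto simp: N_def)
        then show ?thesis using x by (simp add: abs_mult mult_ac)
      next
        case False
        then have "indicator U x *\<^sub>R (divergence F x * (h n x * \<phi> x)) = 0"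
          by (auto simp: indicator_def)
        moreover have "0 \<le> (DIM('a) * B) * (indicator {x\<in>K. F x \<noteq> 0} x *\<^sub>R N x)"
          using N_nonneg[of x] K B(2) by (auto simp: indicator_def U_def)
        ultimately show ?thesis by (simp only: norm_zero)
      qed
    qed
  qed
  have grad_zero: "grad \<phi> x = 0" if "x \<in> S - K" for x
    using grad_eq_0_off_support[OF S compact_imp_closed[OF K(1)] zero that] .
  have F\<phi>_int: "set_integrable lborel S (\<lambda>x. F x \<bullet> grad \<phi> x)"
    using grad_zero
    by (intro set_integrable_of_compact_support[OF S _ K] continuous_intros continuous_on_grad F \<phi>) auto
  define T where "T n x = h n x * (F x \<bullet> grad \<phi> x) + \<phi> x * cutoff_deriv (\<epsilon> n) (q x) * (F x \<bullet> grad q x)" for n x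
  have T: "F x \<bullet> grad (\<lambda>x. h n x * \<phi> x) x = T n x" if "x \<in> U" for n x
    using that by (simp add: C1_on_mult(2)[OF h(1) \<phi>U] h(2) T_def inner_add_right)
  have T_cont: "continuous_on U (T n)" for n
    unfolding T_def
    by (intro continuous_intros C1_on_continuous_on[OF h(1)] C1_on_continuous_on[OF F1]
        C1_on_continuous_on[OF \<phi>U] continuous_on_grad[OF \<phi>U] continuous_on_grad[OF q(1)]
        continuous_on_compose2[OF continuous_on_cutoff_deriv C1_on_continuous_on[OF q(1)]])
      (use q(2) in auto)
  have lim2: "(\<lambda>n. LINT x:U|lborel. T n x) \<longlonglongrightarrow> (LINT x:S|lborel. F x \<bullet> grad \<phi> x)"
    unfolding set_lebesgue_integral_def
  proof (rule integral_dominated_convergence)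
    show "(\<lambda>x. indicator S x *\<^sub>R (F x \<bullet> grad \<phi> x)) \<in> borel_measurable lborel"
      using F\<phi>_int unfolding set_integrable_def by (rule borel_measurable_integrable)
    show "(\<lambda>x. indicator U x *\<^sub>R T n x) \<in> borel_measurable lborel" for n
      using set_borel_measurable_lborel_continuous_on[OF U T_cont]
      by (simp add: set_borel_measurable_def)
    show "integrable lborel (\<lambda>x. norm (indicator S x *\<^sub>R (F x \<bullet> grad \<phi> x)) +
        (4 * B) * (indicator {x\<in>K. F x \<noteq> 0} x *\<^sub>R N x))"
      using F\<phi>_int N_int unfolding set_integrable_def
      by (intro Bochner_Integration.integrable_add integrable_norm integrable_mult_right)
    show "AE x in lborel. (\<lambda>n. indicator U x *\<^sub>R T n x)
        \<longlonglongrightarrow> indicator S x *\<^sub>R (F x \<bullet> grad \<phi> x)"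
    proof (intro AE_I2)
      fix x
      show "(\<lambda>n. indicator U x *\<^sub>R T n x) \<longlonglongrightarrow> indicator S x *\<^sub>R (F x \<bullet> grad \<phi> x)"
      proof (cases "x \<in> U")
        case True
        have "(\<lambda>n. T n x) \<longlonglongrightarrow> 1 * (F x \<bullet> grad \<phi> x) + \<phi> x * 0 * (F x \<bullet> grad q x)"
          unfolding T_def h_def by (intro tendsto_intros cutoff_tendsto q True \<epsilon>)
        then show ?thesis using True by (simp add: U_def)
      next
        case False
        then show ?thesis by (auto simp: U_def indicator_def)
      qed
    qed
    show "AE x in lborel. norm (indicator U x *\<^sub>R T n x) \<le>
        norm (indicator S x *\<^sub>R (F x \<bullet> grad \<phi> x)) + (4 * B) * (indicator {x\<in>K. F x \<noteq> 0} x *\<^sub>R N x)" for n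
    proof (intro AE_I2)
      fix x
      have rhs: "0 \<le> (4 * B) * (indicator {x\<in>K. F x \<noteq> 0} x *\<^sub>R N x)"
        using N_nonneg[of x] K B(2) by (auto simp: indicator_def U_def)
      show "norm (indicator U x *\<^sub>R T n x) \<le>
        norm (indicator S x *\<^sub>R (F x \<bullet> grad \<phi> x)) + (4 * B) * (indicator {x\<in>K. F x \<noteq> 0} x *\<^sub>R N x)"
      proof (cases "x \<in> U")
        case True
        have "\<bar>h n x * (F x \<bullet> grad \<phi> x)\<bar> \<le> 1 * \<bar>F x \<bullet> grad \<phi> x\<bar>"
          unfolding abs_mult using h_range(1)[of n x] h_range(2)[of x n] True by (intro mult_right_mono) auto
        moreover have "\<bar>\<phi> x * cutoff_deriv (\<epsilon> n) (q x) * (F x \<bullet> grad q x)\<bar>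
            \<le> (4 * B) * (indicator {x\<in>K. F x \<noteq> 0} x *\<^sub>R N x)"
        proof (cases "\<phi> x = 0")
          case True
          then show ?thesis using rhs by simp
        next
          case False
          then have x: "x \<in> K" "F x \<noteq> 0" using UK[OF True] by auto
          have "\<bar>cutoff_deriv (\<epsilon> n) (q x)\<bar> * \<bar>F x \<bullet> grad q x\<bar>
              \<le> \<bar>cutoff_deriv (\<epsilon> n) (q x)\<bar> * (2 * N x * q x)"
            using q_grad[OF True] by (rule mult_left_mono) simp
          also have "\<dots> = 2 * N x * (\<bar>cutoff_deriv (\<epsilon> n) (q x)\<bar> * q x)" by simp
          also have "\<dots> \<le> 2 * N x * 2"
            using cutoff_deriv_bound[OF \<epsilon>(1) q(2)[OF True]] N_nonneg[OF True]
            by (intro mult_left_mono) auto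
          finally have "\<bar>cutoff_deriv (\<epsilon> n) (q x)\<bar> * \<bar>F x \<bullet> grad q x\<bar> \<le> 2 * N x * 2" .
          from mult_mono[OF B(1)[OF x(1)] this] show ?thesis
            using x B(2) by (simp add: abs_mult mult_ac)
        qed
        ultimately have "\<bar>T n x\<bar> \<le> \<bar>F x \<bullet> grad \<phi> x\<bar> + (4 * B) * (indicator {x\<in>K. F x \<noteq> 0} x *\<^sub>R N x)"
          unfolding T_def by linarith
        then show ?thesis using True by (simp add: U_def)
      next
        case False
        then show ?thesis using rhs by simp
      qed
    qed
  qed
  have "(LINT x:U|lborel. F x \<bullet> grad (\<lambda>x. h n x * \<phi> x) x) = (LINT x:U|lborel. T n x)" for n
    using U T by (intro set_lebesgue_integral_cong) auto
  then have "(\<lambda>n. - (LINT x:U|lborel. T n x)) \<longlonglongrightarrow> (LINT x:U|lborel. divergence F x * \<phi> x)"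
    using lim1 by (simp add: parts)
  with tendsto_minus[OF lim2] show ?thesis
    unfolding U_def[symmetric] by (metis LIMSEQ_unique)
qed

text \<open>
  In each of the cases that define the integral of \<open>(div F) \<phi>\<close>, it is the value of the
  distribution \<open>div F\<close> at \<open>\<phi>\<close>: by integration by parts in the first two, by definition in the
  last.
\<close>

proposition integral_div_times_eq:
  fixes F :: "'a::euclidean_space \<Rightarrow> 'a"
  assumes S: "open S" and \<phi>: "C1_on S \<phi>" and K: "compact K" "K \<subseteq> S"
    and zero: "\<And>x. x \<in> S - K \<Longrightarrow> \<phi> x = 0"
  shows "integral_div_times S F \<phi> = - (LINT x:S|lborel. F x \<bullet> grad \<phi> x)"
  unfolding integral_div_times_def
  using set_integral_divergence_mult[OF S _ \<phi> K zero]
    set_integral_divergence_off_zeros_mult[OF S _ \<phi> K zero] K by auto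

section \<open>Balancing the two energies\<close>

lemma powr_minus_2_mult:
  fixes t :: real
  assumes "t \<ge> 0"
  shows "t powr (p - 2) * t = t powr (p - 1)"
  using assms powr_mult_base[of t "p - 2"] by (cases "t = 0") (auto simp: mult.commute)

lemma R_p_scaleR:
  fixes a b :: "'v::real_inner"
  assumes "\<alpha> \<ge> 0" "\<beta> \<ge> 0"
  shows "R_p p (\<alpha> *\<^sub>R a) (\<beta> *\<^sub>R b) =
    \<beta> powr p * norm b powr p + (p - 1) * (\<alpha> powr p * norm a powr p)
      - p * (\<alpha> powr (p - 1) * \<beta>) * (norm a powr (p - 2) * (a \<bullet> b))"
proof -
  have "p * (\<alpha> powr (p - 2) * norm a powr (p - 2)) * (\<alpha> * (\<beta> * (a \<bullet> b)))
      = p * ((\<alpha> powr (p - 2) * \<alpha>) * \<beta>) * (norm a powr (p - 2) * (a \<bullet> b))"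
    by (simp only: mult_ac)
  then show ?thesis
    using assms by (simp add: R_p_def powr_mult powr_minus_2_mult)
qed

lemma set_AE_eq_0_of_integral_eq_0:
  fixes f :: "'a \<Rightarrow> real"
  assumes "set_integrable M S f" "\<And>x. x \<in> S \<Longrightarrow> f x \<ge> 0" "(LINT x:S|M. f x) = 0"
  shows "AE x in M. x \<in> S \<longrightarrow> f x = 0"
proof -
  have "AE x in M. indicator S x *\<^sub>R f x = 0"
    using assms integral_nonneg_eq_0_iff_AE[of M "\<lambda>x. indicator S x *\<^sub>R f x"]
    by (auto simp: set_integrable_def set_lebesgue_integral_def indicator_def)
  then show ?thesis by eventually_elim (auto simp: indicator_def)
qed

lemma set_integral_eq_0_AE:
  fixes f :: "'a \<Rightarrow> real"
  assumes "AE x in M. x \<in> S \<longrightarrow> f x = 0"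
  shows "(LINT x:S|M. f x) = 0"
  unfolding set_lebesgue_integral_def
  by (rule integral_eq_zero_AE) (use assms in \<open>auto simp: indicator_def\<close>)

text \<open>
  Expanding \<open>R_p (\<alpha> a) (\<beta> b)\<close> gives the integrals
  \<open>\<beta>^p G + (p - 1) \<alpha>^p H - p \<alpha>^(p-1) \<beta> C\<close>, where \<open>C\<close> is the integral of the cross term. The factors
  \<open>\<alpha>\<close> and \<open>\<beta>\<close> are those with \<open>\<alpha>^(p-1) \<beta> = 1\<close> for which \<open>\<beta>^p G\<close> and \<open>\<alpha>^p H\<close> coincide; the common
  value is then \<open>G^(1/p) H^((p-1)/p)\<close>. If \<open>G\<close> or \<open>H\<close> is \<open>0\<close>, then \<open>\<alpha> = \<beta> = 0\<close> by the convention
  for division by zero, and the identity says that \<open>C = 0\<close>. This holds because \<open>A b\<close> or \<open>A a\<close>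
  vanishes almost everywhere.
\<close>

proposition integral_R_p_balanced:
  fixes a b :: "'a \<Rightarrow> 'v::real_inner" and A :: "'a \<Rightarrow> real" and p :: real
  assumes p: "p > 1"
    and A: "\<And>x. x \<in> S \<Longrightarrow> A x \<ge> 0"
    and int_a: "set_integrable M S (\<lambda>x. A x * norm (a x) powr p)"
    and int_b: "set_integrable M S (\<lambda>x. A x * norm (b x) powr p)"
    and int_ab: "set_integrable M S (\<lambda>x. A x * (norm (a x) powr (p - 2) * (a x \<bullet> b x)))"
    and H: "H = (LINT x:S|M. A x * norm (a x) powr p)"
    and G: "G = (LINT x:S|M. A x * norm (b x) powr p)"
  shows "G powr (1 / p) * H powr ((p - 1) / p) - (LINT x:S|M. A x * (norm (a x) powr (p - 2) * (a x \<bullet> b x)))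
    = (1 / p) * (LINT x:S|M. A x * R_p p (((G / H) powr (1 / p\<^sup>2)) *\<^sub>R a x) (((H / G) powr ((p - 1) / p\<^sup>2)) *\<^sub>R b x))"
proof -
  define C where "C = (LINT x:S|M. A x * (norm (a x) powr (p - 2) * (a x \<bullet> b x)))"
  define \<alpha> where "\<alpha> = (G / H) powr (1 / p\<^sup>2)"
  define \<beta> where "\<beta> = (H / G) powr ((p - 1) / p\<^sup>2)"
  define P where "P = G powr (1 / p) * H powr ((p - 1) / p)"
  have nonneg: "G \<ge> 0" "H \<ge> 0"
    unfolding G H set_lebesgue_integral_def using A
    by (auto intro!: integral_nonneg_AE AE_I2 simp: indicator_def)
  have "(LINT x:S|M. A x * R_p p (\<alpha> *\<^sub>R a x) (\<beta> *\<^sub>R b x)) =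
      (LINT x:S|M. (\<beta> powr p * (A x * norm (b x) powr p) + (p - 1) * \<alpha> powr p * (A x * norm (a x) powr p))
        - p * (\<alpha> powr (p - 1) * \<beta>) * (A x * (norm (a x) powr (p - 2) * (a x \<bullet> b x))))"
    by (simp add: R_p_scaleR \<alpha>_def \<beta>_def algebra_simps)
  also have "\<dots> = (\<beta> powr p * G + (p - 1) * \<alpha> powr p * H) - p * (\<alpha> powr (p - 1) * \<beta>) * C"
    using int_a int_b int_ab by (simp add: G H C_def)
  also have "\<dots> = p * (P - C)"
  proof (cases "G = 0 \<or> H = 0")
    case True
    have "AE x in M. x \<in> S \<longrightarrow> A x * (norm (a x) powr (p - 2) * (a x \<bullet> b x)) = 0"
      using True
    proof
      assume "G = 0"
      then have "AE x in M. x \<in> S \<longrightarrow> A x * norm (b x) powr p = 0"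
        using int_b A by (intro set_AE_eq_0_of_integral_eq_0) (auto simp: G)
      then show ?thesis by eventually_elim auto
    next
      assume "H = 0"
      then have "AE x in M. x \<in> S \<longrightarrow> A x * norm (a x) powr p = 0"
        using int_a A by (intro set_AE_eq_0_of_integral_eq_0) (auto simp: H)
      then show ?thesis by eventually_elim auto
    qed
    then have "C = 0" unfolding C_def by (rule set_integral_eq_0_AE)
    then show ?thesis using True by (auto simp: \<alpha>_def \<beta>_def P_def)
  next
    case False
    with nonneg have pos: "G > 0" "H > 0" by auto
    have e: "(p - 1) * p / p\<^sup>2 = (p - 1) / p" "p / p\<^sup>2 = 1 / p" "1 / p\<^sup>2 * (p - 1) = (p - 1) / p\<^sup>2"
      using p by (auto simp: power2_eq_square)
    have e': "G powr (1 / p) = G / G powr ((p - 1) / p)" "H powr ((p - 1) / p) = H / H powr (1 / p)"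
      using pos p powr_diff[of G 1 "(p - 1) / p"] powr_diff[of H 1 "1 / p"]
      by (auto simp: diff_divide_distrib)
    have "\<beta> powr p * G = P"
      using pos by (simp add: \<beta>_def powr_powr e powr_divide P_def e'(1))
    moreover have "\<alpha> powr p * H = P"
      using pos by (simp add: \<alpha>_def powr_powr e powr_divide P_def e'(2))
    moreover have "\<alpha> powr (p - 1) * \<beta> = 1"
      using pos by (simp add: \<alpha>_def \<beta>_def powr_powr e powr_divide)
    ultimately show ?thesis by (simp add: algebra_simps)
  qed
  finally show ?thesis
    using p unfolding P_def C_def \<alpha>_def \<beta>_def by simp
qed

lemma set_integrable_of_compact_support_dominated:
  fixes f g :: "'a::euclidean_space \<Rightarrow> real"
  assumes S: "open S" and K: "compact K" "K \<subseteq> S"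
    and g: "continuous_on S g" "\<And>x. x \<in> S - K \<Longrightarrow> g x = 0"
    and f: "f \<in> borel_measurable (restrict_space borel S)" "\<And>x. x \<in> S \<Longrightarrow> \<bar>f x\<bar> \<le> g x"
  shows "set_integrable lborel S f"
proof (rule set_integrable_bound[OF set_integrable_of_compact_support[OF S g(1) K g(2)]])
  show "set_borel_measurable lborel S f"
    using f(1) S by (simp add: set_borel_measurable_def borel_measurable_restrict_space_iff)
  show "AE x in lborel. x \<in> S \<longrightarrow> norm (f x) \<le> norm (g x)"
    using f(2) by (intro AE_I2) force
qed

theorem theorem1p4:
  fixes \<Omega> :: "(real ^ 'N) set"
    and p :: real
    and A :: "real ^ 'N \<Rightarrow> real"
    and X :: "real ^ 'N \<Rightarrow> real ^ 'N"
    and u :: "real ^ 'N \<Rightarrow> real"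
    and G G\<^sub>X H :: real
  assumes "open \<Omega>"
    and "p > 1"
    and "C1_on \<Omega> A"
    and "\<forall>x\<in>\<Omega>. A x \<ge> 0"
    and "C1_on \<Omega> X"
    and "C1_compact_support_on \<Omega> u"
    and "G = (LINT x:\<Omega>|lborel. A x * norm (grad u x) powr p)"
    and "G\<^sub>X = (LINT x:\<Omega>|lborel. A x * \<bar>(X x /\<^sub>R norm (X x)) \<bullet> grad u x\<bar> powr p)"
    and "H = (LINT x:\<Omega>|lborel. A x * norm (X x) powr p * \<bar>u x\<bar> powr p)"
  shows
    "G powr (1 / p) * H powr ((p - 1) / p)
       + (1 / p) * integral_div_times \<Omega> (\<lambda>x. (A x * norm (X x) powr (p - 2)) *\<^sub>R X x)
                     (\<lambda>x. \<bar>u x\<bar> powr p)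
     = (1 / p) * (LINT x:\<Omega>|lborel. A x *
         R_p p (((G / H) powr (1 / p\<^sup>2) * u x) *\<^sub>R X x)
               (((H / G) powr ((p - 1) / p\<^sup>2)) *\<^sub>R grad u x))
     \<and>
     G\<^sub>X powr (1 / p) * H powr ((p - 1) / p)
       + (1 / p) * integral_div_times \<Omega> (\<lambda>x. (A x * norm (X x) powr (p - 2)) *\<^sub>R X x)
                     (\<lambda>x. \<bar>u x\<bar> powr p)
     = (1 / p) * (LINT x:\<Omega>|lborel. A x *
         R_p p ((G\<^sub>X / H) powr (1 / p\<^sup>2) * u x * norm (X x))
               ((H / G\<^sub>X) powr ((p - 1) / p\<^sup>2) * ((X x /\<^sub>R norm (X x)) \<bullet> grad u x)))"
proof -
  note \<Omega> = \<open>open \<Omega>\<close> and p = \<open>p > 1\<close>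
  define K where "K = closure (support_on \<Omega> u)"
  have u: "C1_on \<Omega> u" and K: "compact K" "K \<subseteq> \<Omega>"
    using \<open>C1_compact_support_on \<Omega> u\<close> by (auto simp: C1_compact_support_on_def K_def)
  have u_zero: "u x = 0" if "x \<in> \<Omega> - K" for x
    using that closure_subset[of "support_on \<Omega> u"] by (auto simp: K_def support_on_def)
  have grad_zero: "grad u x = 0" if "x \<in> \<Omega> - K" for x
    using grad_eq_0_off_support[OF \<Omega> compact_imp_closed[OF K(1)] u_zero that] .
  have cont: "continuous_on \<Omega> A" "continuous_on \<Omega> X" "continuous_on \<Omega> u" "continuous_on \<Omega> (grad u)"
    using assms u by (auto intro: C1_on_continuous_on continuous_on_grad)
  note meas [measurable] = cont[THEN borel_measurable_continuous_on_restrict]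
  have A: "A x \<ge> 0" if "x \<in> \<Omega>" for x using assms that by blast

  \<comment> \<open>The unit vector along \<open>X\<close>, which is \<open>0\<close> where \<open>X\<close> vanishes; there it need not be continuous.\<close>
  define \<nu> where "\<nu> x = X x /\<^sub>R norm (X x)" for x
  have \<nu>_meas [measurable]: "\<nu> \<in> borel_measurable (restrict_space borel \<Omega>)"
    unfolding \<nu>_def by measurable
  have \<nu>_le: "\<bar>\<nu> x \<bullet> grad u x\<bar> \<le> norm (grad u x)" for x
    using Cauchy_Schwarz_ineq2[of "\<nu> x" "grad u x"] by (cases "X x = 0") (auto simp: \<nu>_def)
  have X_eq: "X x = norm (X x) *\<^sub>R \<nu> x" for x
    by (cases "X x = 0") (auto simp: \<nu>_def)

  \<comment> \<open>Both choices of the pair \<open>(a, b)\<close> have the same cross term, because \<open>X = |X| \<nu>\<close>.\<close>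
  have cross: "norm (u x *\<^sub>R X x) powr (p - 2) * (u x *\<^sub>R X x \<bullet> grad u x) =
      (\<bar>u x\<bar> powr (p - 2) * u x) * (norm (X x) powr (p - 2) * (X x \<bullet> grad u x))" for x
    by (simp add: powr_mult)
  have cross': "norm (u x * norm (X x)) powr (p - 2) * ((u x * norm (X x)) \<bullet> (\<nu> x \<bullet> grad u x)) =
      (\<bar>u x\<bar> powr (p - 2) * u x) * (norm (X x) powr (p - 2) * (X x \<bullet> grad u x))" for x
    by (subst (4) X_eq) (simp add: powr_mult abs_mult)

  \<comment> \<open>One integral serves both identities; up to the factor \<open>- p\<close> it is the divergence term.\<close>
  define C where "C = (LINT x:\<Omega>|lborel. A x *
    ((\<bar>u x\<bar> powr (p - 2) * u x) * (norm (X x) powr (p - 2) * (X x \<bullet> grad u x))))"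
  have int_C: "set_integrable lborel \<Omega> (\<lambda>x. A x *
    ((\<bar>u x\<bar> powr (p - 2) * u x) * (norm (X x) powr (p - 2) * (X x \<bullet> grad u x))))"
  proof (rule set_integrable_of_compact_support_dominated[OF \<Omega> K])
    \<comment> \<open>For \<open>p < 2\<close> the factors with exponent \<open>p - 2\<close> are unbounded near zeros; combined with \<open>u\<close>
      and \<open>X\<close> they are dominated by powers with the positive exponent \<open>p - 1\<close>.\<close>
    let ?g = "\<lambda>x. A x * (\<bar>u x\<bar> powr (p - 1) * (norm (X x) powr (p - 1) * norm (grad u x)))"
    show "continuous_on \<Omega> ?g"
      using p by (intro continuous_intros continuous_on_powr' cont) auto
    show "?g x = 0" if "x \<in> \<Omega> - K" for x
      using grad_zero[OF that] by simp
    show "\<bar>A x * ((\<bar>u x\<bar> powr (p - 2) * u x) * (norm (X x) powr (p - 2) * (X x \<bullet> grad u x)))\<bar> \<le> ?g x"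
      if "x \<in> \<Omega>" for x
    proof -
      have "norm (X x) powr (p - 2) * \<bar>X x \<bullet> grad u x\<bar>
          \<le> norm (X x) powr (p - 2) * (norm (X x) * norm (grad u x))"
        by (intro mult_left_mono Cauchy_Schwarz_ineq2) auto
      also have "\<dots> = norm (X x) powr (p - 1) * norm (grad u x)"
        by (simp add: powr_minus_2_mult flip: mult.assoc)
      finally show ?thesis
        using A[OF that] by (simp add: abs_mult powr_minus_2_mult mult_left_mono)
    qed
  qed measurable
  have int_G: "set_integrable lborel \<Omega> (\<lambda>x. A x * norm (grad u x) powr p)"
    using p grad_zero
    by (intro set_integrable_of_compact_support[OF \<Omega> _ K] continuous_intros continuous_on_powr' cont) auto
  have int_GX: "set_integrable lborel \<Omega> (\<lambda>x. A x * norm (\<nu> x \<bullet> grad u x) powr p)"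
  proof (rule set_integrable_of_compact_support_dominated[OF \<Omega> K])
    show "continuous_on \<Omega> (\<lambda>x. A x * norm (grad u x) powr p)"
      using p by (intro continuous_intros continuous_on_powr' cont) auto
    show "A x * norm (grad u x) powr p = 0" if "x \<in> \<Omega> - K" for x
      using grad_zero[OF that] by simp
    show "\<bar>A x * norm (\<nu> x \<bullet> grad u x) powr p\<bar> \<le> A x * norm (grad u x) powr p" if "x \<in> \<Omega>" for x
      using A[OF that] p \<nu>_le[of x] by (auto simp: abs_mult intro!: mult_left_mono powr_mono2)
  qed measurable
  have int_H: "set_integrable lborel \<Omega> (\<lambda>x. A x * norm (X x) powr p * \<bar>u x\<bar> powr p)"
    using p u_zero
    by (intro set_integrable_of_compact_support[OF \<Omega> _ K] continuous_intros continuous_on_powr' cont) auto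
  have GX_eq: "G\<^sub>X = (LINT x:\<Omega>|lborel. A x * norm (\<nu> x \<bullet> grad u x) powr p)"
    using assms by (simp add: \<nu>_def)
  have H_eq: "A x * norm (u x *\<^sub>R X x) powr p = A x * norm (X x) powr p * \<bar>u x\<bar> powr p"
    "A x * norm (u x * norm (X x)) powr p = A x * norm (X x) powr p * \<bar>u x\<bar> powr p" for x
    by (simp_all add: powr_mult abs_mult)

  have div: "integral_div_times \<Omega> (\<lambda>x. (A x * norm (X x) powr (p - 2)) *\<^sub>R X x) (\<lambda>x. \<bar>u x\<bar> powr p) = - (p * C)"
  proof -
    note \<phi> = C1_on_compose_real[OF u, of UNIV "\<lambda>t. \<bar>t\<bar> powr p", OF _ has_real_derivative_abs_powr[OF p]
        continuous_on_abs_powr_mult[OF p]]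
    have "integral_div_times \<Omega> (\<lambda>x. (A x * norm (X x) powr (p - 2)) *\<^sub>R X x) (\<lambda>x. \<bar>u x\<bar> powr p) =
        - (LINT x:\<Omega>|lborel. ((A x * norm (X x) powr (p - 2)) *\<^sub>R X x) \<bullet> grad (\<lambda>x. \<bar>u x\<bar> powr p) x)"
      using u_zero \<phi>(1) by (intro integral_div_times_eq[OF \<Omega> _ K]) auto
    also have "(LINT x:\<Omega>|lborel. ((A x * norm (X x) powr (p - 2)) *\<^sub>R X x) \<bullet> grad (\<lambda>x. \<bar>u x\<bar> powr p) x) =
        (LINT x:\<Omega>|lborel. p * (A x *
          ((\<bar>u x\<bar> powr (p - 2) * u x) * (norm (X x) powr (p - 2) * (X x \<bullet> grad u x)))))"
      using \<Omega> \<phi>(2) by (intro set_lebesgue_integral_cong) (auto simp: mult_ac)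
    also have "\<dots> = p * C" by (simp add: C_def)
    finally show ?thesis .
  qed

  have "G powr (1 / p) * H powr ((p - 1) / p) - C = (1 / p) * (LINT x:\<Omega>|lborel. A x *
      R_p p (((G / H) powr (1 / p\<^sup>2)) *\<^sub>R (u x *\<^sub>R X x)) (((H / G) powr ((p - 1) / p\<^sup>2)) *\<^sub>R grad u x))"
    unfolding C_def cross[symmetric]
    by (rule integral_R_p_balanced[OF p A])
      (use assms int_C int_G int_H in \<open>simp_all only: cross H_eq\<close>)
  moreover have "G\<^sub>X powr (1 / p) * H powr ((p - 1) / p) - C = (1 / p) * (LINT x:\<Omega>|lborel. A x *
      R_p p (((G\<^sub>X / H) powr (1 / p\<^sup>2)) *\<^sub>R (u x * norm (X x)))
        (((H / G\<^sub>X) powr ((p - 1) / p\<^sup>2)) *\<^sub>R (\<nu> x \<bullet> grad u x)))"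
    unfolding C_def cross'[symmetric]
    by (rule integral_R_p_balanced[OF p A])
      (use assms GX_eq int_C int_GX int_H in \<open>simp_all only: cross' H_eq\<close>)
  ultimately show ?thesis
    using p unfolding div \<nu>_def by (simp add: mult.assoc)
qed

end
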